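(* Let $(X,d)$ be a complete geodesic metric space. Then $(X,d)$ is locally compact if and only if it is regular, i.e. if and only if for every bounded nondecreasing chain $(K_\alpha)_{\alpha\in A}$ of compact subsets of $X$ the Painlevé–Kuratowski limit $\operatorname{Lim}_\alpha K_\alpha$ is compact.
   Context: A geodesic segment from $x$ to $y$ in a metric space $(X,d)$ is a map $\gamma:[0,\ell]\to X$ with $\gamma(0)=x$, $\gamma(\ell)=y$ and $d(\gamma(t_1),\gamma(t_2))=|t_1-t_2|$ for all $t_1,t_2$. $(X,d)$ is a geodesic metric space if every two points are joined by a geodesic segment. Let $(A,\preceq)$ be a directed set. A family $(S_\alpha)_{\alpha\in A}$ of subsets of $X$ is a net of sets; it is nondecreasing if $S_\alpha\subseteq S_\beta$ whenever $\alpha\preceq\beta$. It is a chain if for all $\alpha\ne\beta$ one has $S_\alpha\subseteq S_\beta$ or $S_\beta\subseteq S_\alpha$. It is bounded if $\bigcup_\alpha S_\alpha$ is a bounded set. With $\mathcal N(x)$ the collection of neighborhoods of $x$, the Painlevé–Kuratowski outer limit $\operatorname{Ls}_\alpha S_\alpha$ is the set of $x\in X$ such that for every $V\in\mathcal N(x)$ and every $\alpha_0\in A$ there is $\alpha\succeq\alpha_0$ with $V\cap S_\alpha\neq\emptyset$; the inner limit $\operatorname{Li}_\alpha S_\alpha$ is the set of $x\in X$ such that for every $V\in\mathcal N(x)$ there is $\alpha_0\in A$ with $V\cap S_\alpha\ne\emptyset$ for all $\alpha\succeq\alpha_0$. If the two coincide, the common set is the limit $\operatorname{Lim}_\alpha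 S_\alpha$. (For nondecreasing chains the limit always exists.) *)

theory Defs
  imports "HOL-Analysis.Analysis"
begin

definition geodesic_segment :: "'a::metric_space \<Rightarrow> 'a \<Rightarrow> real \<Rightarrow> (real \<Rightarrow> 'a) \<Rightarrow> bool" where
  "geodesic_segment x y l \<gamma> \<longleftrightarrow>
     0 \<le> l \<and> \<gamma> 0 = x \<and> \<gamma> l = y \<and>
     (\<forall>s\<in>{0..l}. \<forall>t\<in>{0..l}. dist (\<gamma> s) (\<gamma> t) = \<bar>s - t\<bar>)"

definition geodesic_space :: "'a::metric_space itself \<Rightarrow> bool" where
  "geodesic_space _ \<longleftrightarrow> (\<forall>x y :: 'a. \<exists>l \<gamma>. geodesic_segment x y l \<gamma>)"

text \<open>A directed set is a nonempty preordered set (not necessarily antisymmetric) in which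
  any two elements have an upper bound; \<open>(a, b) \<in> r\<close> stands for \<open>a \<preceq> b\<close>.\<close>

definition directed_set :: "'i set \<Rightarrow> 'i rel \<Rightarrow> bool" where
  "directed_set A r \<longleftrightarrow>
     A \<noteq> {} \<and> preorder_on A r \<and> (\<forall>a\<in>A. \<forall>b\<in>A. \<exists>c\<in>A. (a, c) \<in> r \<and> (b, c) \<in> r)"

definition nondecreasing_net :: "'i set \<Rightarrow> 'i rel \<Rightarrow> ('i \<Rightarrow> 'a set) \<Rightarrow> bool" where
  "nondecreasing_net A r S \<longleftrightarrow> (\<forall>a\<in>A. \<forall>b\<in>A. (a, b) \<in> r \<longrightarrow> S a \<subseteq> S b)"

definition chain_net :: "'i set \<Rightarrow> ('i \<Rightarrow> 'a set) \<Rightarrow> bool" where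
  "chain_net A S \<longleftrightarrow> (\<forall>a\<in>A. \<forall>b\<in>A. a \<noteq> b \<longrightarrow> S a \<subseteq> S b \<or> S b \<subseteq> S a)"

definition bounded_net :: "'i set \<Rightarrow> ('i \<Rightarrow> 'a::metric_space set) \<Rightarrow> bool" where
  "bounded_net A S \<longleftrightarrow> bounded (\<Union>a\<in>A. S a)"

text \<open>Painlev\'e--Kuratowski limits. A neighborhood of \<open>x\<close> is a set, not necessarily open,
  with \<open>x\<close> in its interior.\<close>

definition PK_Ls :: "'i set \<Rightarrow> 'i rel \<Rightarrow> ('i \<Rightarrow> 'a::topological_space set) \<Rightarrow> 'a set" where
  "PK_Ls A r S =
     {x. \<forall>V. x \<in> interior V \<longrightarrow> (\<forall>a0\<in>A. \<exists>a\<in>A. (a0, a) \<in> r \<and> V \<inter> S a \<noteq> {})}"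

definition PK_Li :: "'i set \<Rightarrow> 'i rel \<Rightarrow> ('i \<Rightarrow> 'a::topological_space set) \<Rightarrow> 'a set" where
  "PK_Li A r S =
     {x. \<forall>V. x \<in> interior V \<longrightarrow> (\<exists>a0\<in>A. \<forall>a\<in>A. (a0, a) \<in> r \<longrightarrow> V \<inter> S a \<noteq> {})}"

definition has_PK_Lim :: "'i set \<Rightarrow> 'i rel \<Rightarrow> ('i \<Rightarrow> 'a::topological_space set) \<Rightarrow> 'a set \<Rightarrow> bool" where
  "has_PK_Lim A r S L \<longleftrightarrow> PK_Ls A r S = L \<and> PK_Li A r S = L"

lemma has_PK_Lim_nondecreasing:
  assumes "directed_set A r" and "nondecreasing_net A r S"
  shows "has_PK_Lim A r S (closure (\<Union>a\<in>A. S a))"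
proof -
  let ?U = "\<Union>a\<in>A. S a"
  have cl: "x \<in> closure ?U \<longleftrightarrow> (\<forall>V. x \<in> interior V \<longrightarrow> V \<inter> ?U \<noteq> {})" for x
  proof
    assume x: "x \<in> closure ?U"
    show "\<forall>V. x \<in> interior V \<longrightarrow> V \<inter> ?U \<noteq> {}"
    proof (intro allI impI)
      fix V assume "x \<in> interior V"
      then have "interior V \<inter> ?U \<noteq> {}"
        using x open_Int_closure_eq_empty[OF open_interior, of V ?U] by (metis IntI empty_iff)
      then show "V \<inter> ?U \<noteq> {}"
        using Int_mono[OF interior_subset[of V] order_refl[of ?U]] by (metis subset_empty)
    qed
  next
    assume V: "\<forall>V. x \<in> interior V \<longrightarrow> V \<inter> ?U \<noteq> {}"
    show "x \<in> closure ?U"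
    proof (rule ccontr)
      assume "x \<notin> closure ?U"
      then have "x \<in> interior (- ?U)" by (simp only: interior_complement Compl_iff not_False_eq_True)
      then have "- ?U \<inter> ?U \<noteq> {}" using V by (elim allE impE)
      then show False by (simp only: Compl_disjoint2 simp_thms)
    qed
  qed
  have rf: "(a, a) \<in> r" if "a \<in> A" for a
    using assms(1) that unfolding directed_set_def preorder_on_def refl_on_def by metis
  have ne: "A \<noteq> {}" and dir: "\<And>a b. a \<in> A \<Longrightarrow> b \<in> A \<Longrightarrow> \<exists>c\<in>A. (a, c) \<in> r \<and> (b, c) \<in> r"
    using assms(1) unfolding directed_set_def by auto
  have mono: "S a \<subseteq> S b" if "a \<in> A" "b \<in> A" "(a, b) \<in> r" for a b
    using assms(2) that unfolding nondecreasing_net_def by metis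
  have ls: "(\<forall>a0\<in>A. \<exists>a\<in>A. (a0, a) \<in> r \<and> V \<inter> S a \<noteq> {}) \<longleftrightarrow> V \<inter> ?U \<noteq> {}" (is "?P \<longleftrightarrow> _") for V
  proof
    assume P: ?P
    obtain a0 where "a0 \<in> A" using ne by auto
    with P obtain a where "a \<in> A" "V \<inter> S a \<noteq> {}" by metis
    then show "V \<inter> ?U \<noteq> {}" by auto
  next
    assume "V \<inter> ?U \<noteq> {}"
    then obtain b where b: "b \<in> A" "V \<inter> S b \<noteq> {}" by auto
    show ?P
    proof
      fix a0 assume a0: "a0 \<in> A"
      obtain c where c: "c \<in> A" "(a0, c) \<in> r" "(b, c) \<in> r" using dir[OF a0 b(1)] by auto
      then have "V \<inter> S c \<noteq> {}" using mono[OF b(1) c(1) c(3)] b(2) by auto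
      then show "\<exists>a\<in>A. (a0, a) \<in> r \<and> V \<inter> S a \<noteq> {}" using c by metis
    qed
  qed
  have li: "(\<exists>a0\<in>A. \<forall>a\<in>A. (a0, a) \<in> r \<longrightarrow> V \<inter> S a \<noteq> {}) \<longleftrightarrow> V \<inter> ?U \<noteq> {}" (is "?P \<longleftrightarrow> _") for V
  proof
    assume ?P
    then obtain a where "a \<in> A" "V \<inter> S a \<noteq> {}" using rf by metis
    then show "V \<inter> ?U \<noteq> {}" by auto
  next
    assume "V \<inter> ?U \<noteq> {}"
    then obtain b where b: "b \<in> A" "V \<inter> S b \<noteq> {}" by auto
    have "V \<inter> S a \<noteq> {}" if "a \<in> A" "(b, a) \<in> r" for a
      using mono[OF b(1) that] b(2) by auto
    then show ?P using b(1) by metis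
  qed
  show ?thesis
    unfolding has_PK_Lim_def PK_Ls_def PK_Li_def ls li cl[symmetric] by simp
qed

text \<open>Regularity of the metric space \<open>'a\<close>, for nets whose index set is a subset of the
  type \<open>'i\<close>. HOL cannot quantify over types inside a formula, so the type of the indices is a
  parameter. By the lemma above the limit always exists, so that the existential quantifier
  only serves to name it. This is unrelated to the separation axiom \<open>regular_space\<close>.\<close>

definition PK_regular :: "'a::metric_space itself \<Rightarrow> 'i itself \<Rightarrow> bool" where
  "PK_regular _ _ \<longleftrightarrow>
     (\<forall>(A :: 'i set) (r :: 'i rel) (K :: 'i \<Rightarrow> 'a set).
        directed_set A r \<longrightarrow> nondecreasing_net A r K \<longrightarrow> chain_net A K \<longrightarrow> bounded_net A K \<longrightarrow>
        (\<forall>a\<in>A. compact (K a)) \<longrightarrow>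
        (\<exists>L. has_PK_Lim A r K L \<and> compact L))"

text \<open>Every nondecreasing chain of subsets of \<open>'a\<close> has the same limit as its range, ordered
  by inclusion and indexed by itself. Index sets in \<open>'a set\<close> are therefore enough to express
  regularity with respect to all index sets.\<close>

lemma PK_regular_index:
  assumes "PK_regular TYPE('a::metric_space) TYPE('a set)"
  shows "PK_regular TYPE('a) TYPE('i)"
  unfolding PK_regular_def
proof (intro allI impI)
  fix A :: "'i set" and r :: "'i rel" and K :: "'i \<Rightarrow> 'a set"
  assume A: "directed_set A r" "nondecreasing_net A r K"
    and ch: "chain_net A K" and bd: "bounded_net A K" and cp: "\<forall>a\<in>A. compact (K a)"
  define B where "B = K ` A"
  define q where "q = {(P, Q). P \<in> B \<and> Q \<in> B \<and> P \<subseteq> Q}"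
  have tot: "P \<subseteq> Q \<or> Q \<subseteq> P" if "P \<in> B" "Q \<in> B" for P Q
    using that ch unfolding B_def chain_net_def by (metis imageE order_refl)
  have "B \<noteq> {}" using A(1) unfolding B_def directed_set_def by blast
  moreover have "preorder_on B q"
    unfolding preorder_on_def refl_on_def trans_def q_def by auto
  moreover have "\<forall>P\<in>B. \<forall>Q\<in>B. \<exists>R\<in>B. (P, R) \<in> q \<and> (Q, R) \<in> q"
  proof (intro ballI)
    fix P Q assume PQ: "P \<in> B" "Q \<in> B"
    then consider "P \<subseteq> Q" | "Q \<subseteq> P" using tot by metis
    then show "\<exists>R\<in>B. (P, R) \<in> q \<and> (Q, R) \<in> q"
      using PQ unfolding q_def by cases auto
  qed
  ultimately have B: "directed_set B q" unfolding directed_set_def by blast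
  have nd: "nondecreasing_net B q (\<lambda>P. P)"
    unfolding nondecreasing_net_def q_def by blast
  have "chain_net B (\<lambda>P. P)" using tot unfolding chain_net_def by simp
  moreover have U: "(\<Union>P\<in>B. P) = (\<Union>a\<in>A. K a)" unfolding B_def by blast
  have "bounded_net B (\<lambda>P. P)" using bd unfolding bounded_net_def U .
  moreover have "\<forall>P\<in>B. compact P" using cp unfolding B_def by blast
  ultimately obtain L where L: "has_PK_Lim B q (\<lambda>P. P) L" "compact L"
    using assms[unfolded PK_regular_def] B nd by metis
  have "L = closure (\<Union>a\<in>A. K a)"
    using has_PK_Lim_nondecreasing[OF B nd] L(1) unfolding has_PK_Lim_def U by (metis (no_types))
  then show "\<exists>L. has_PK_Lim A r K L \<and> compact L"
    using has_PK_Lim_nondecreasing[OF A] L(2) by metis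
qed

end

(* A locally compact complete geodesic space is proper (Hopf-Rinow): the radii of the compact
   closed balls around a point form a set that is both open and closed. In a proper space the limit
   of a bounded nondecreasing net is the closure of its union, which is closed and bounded, hence
   compact. Conversely, regularity applied to the finite initial segments of the range of a bounded
   sequence makes the closure of the range compact, so that closed balls are sequentially compact. *)
theory Submission
  imports Defs
begin

text \<open>If \<open>x\<close> lies outside the ball, take the point at parameter \<open>r\<close>
  on a geodesic from \<open>p\<close> to \<open>x\<close>. This is how geodesics enter: enlarging a
  radius by \<open>e\<close> adds only points within \<open>e\<close> of the smaller ball.\<close>

lemma geodesic_space_cball_point:
  fixes p x :: "'a::metric_space"
  assumes "geodesic_space TYPE('a)" "0 \<le> r" "0 \<le> e" "dist p x \<le> r + e"
  obtains y where "y \<in> cball p r" "dist y x \<le> e"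
proof (cases "dist p x \<le> r")
  case True
  with that[of x] assms(3) show ?thesis by simp
next
  case False
  obtain l \<gamma> where \<gamma>: "0 \<le> l" "\<gamma> 0 = p" "\<gamma> l = x"
    and d: "\<forall>s\<in>{0..l}. \<forall>t\<in>{0..l}. dist (\<gamma> s) (\<gamma> t) = \<bar>s - t\<bar>"
    using assms(1) unfolding geodesic_space_def geodesic_segment_def by blast
  have "dist p x = l" using d \<gamma> by force
  then have "r \<in> {0..l}" "l \<le> r + e" using False assms by auto
  then have "dist p (\<gamma> r) = r" "dist (\<gamma> r) x = l - r"
    using d \<gamma> by force+
  with that[of "\<gamma> r"] \<open>l \<le> r + e\<close> show ?thesis by simp
qed

lemma locally_compact_geodesic_compact_cball:
  fixes p :: "'a::complete_space"
  assumes geo: "geodesic_space TYPE('a)"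
    and lc: "locally_compact_space (euclidean :: 'a topology)"
  shows "compact (cball p r)"
proof (rule ccontr)
  assume bad: "\<not> compact (cball p r)"
  define S where "S = {s. compact (cball p s)}"
  define \<rho> where "\<rho> = Sup S"
  have down: "s \<in> S" if "t \<in> S" "s \<le> t" for s t
  proof -
    have "cball p t \<inter> cball p s = cball p s" using that(2) by auto
    then show ?thesis using that(1) compact_Int_closed[of "cball p t" "cball p s"]
      unfolding S_def by simp
  qed
  \<comment> \<open>\<open>S\<close> is closed downwards, so the radius \<open>r\<close> of the
    non-compact ball bounds it.\<close>
  have "bdd_above S"
    using bad down unfolding S_def bdd_above_def by (metis linear mem_Collect_eq)
  have "0 \<in> S" unfolding S_def by simp
  then have "\<rho> \<ge> 0" unfolding \<rho>_def using \<open>bdd_above S\<close> by (rule cSup_upper)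
  have below: "compact (cball p s)" if s: "s < \<rho>" for s
  proof -
    obtain t where "t \<in> S" "s < t"
      using s less_cSup_iff[of S s] \<open>0 \<in> S\<close> \<open>bdd_above S\<close> unfolding \<rho>_def by blast
    then show ?thesis using down[of t s] unfolding S_def by simp
  qed
  \<comment> \<open>Total boundedness at the supremum: a finite \<open>e / 2\<close>-net of a
    slightly smaller compact ball is an \<open>e\<close>-net of the ball of radius
    \<open>\<rho>\<close>.\<close>
  have "\<exists>F. finite F \<and> cball p \<rho> \<subseteq> (\<Union>x\<in>F. ball x e)" if "e > 0" for e
  proof -
    \<comment> \<open>Truncation at 0 keeps the radius admissible for geodesics; the ball of radius
      0 is a singleton, hence compact even if \<open>\<rho> = 0\<close>.\<close>
    define s where "s = max 0 (\<rho> - e / 2)"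
    have "compact (cball p s)"
      using below[of s] \<open>e > 0\<close> unfolding s_def by (cases "\<rho> - e / 2 \<le> 0") (auto simp: max_def)
    then obtain F where F: "finite F" "cball p s \<subseteq> (\<Union>x\<in>F. ball x (e / 2))"
      using \<open>e > 0\<close> unfolding compact_eq_totally_bounded by (meson half_gt_zero)
    have "x \<in> (\<Union>z\<in>F. ball z e)" if "x \<in> cball p \<rho>" for x
    proof -
      have "dist p x \<le> s + e / 2" using that unfolding s_def by auto
      then obtain y where y: "y \<in> cball p s" "dist y x \<le> e / 2"
        using geodesic_space_cball_point[OF geo, of s "e / 2" p x] \<open>e > 0\<close> unfolding s_def by auto
      then obtain z where "z \<in> F" "dist z y < e / 2" using F(2) by auto
      moreover have "dist z x < e"
        using dist_triangle[of z x y] y(2) \<open>dist z y < e / 2\<close> by simp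
      ultimately show ?thesis by auto
    qed
    with F(1) show ?thesis by blast
  qed
  \<comment> \<open>Completeness of the space enters here: a closed, totally bounded set is
    compact.\<close>
  then have cp: "compact (cball p \<rho>)"
    unfolding compact_eq_totally_bounded by (simp add: complete_eq_closed)
  \<comment> \<open>Local compactness passes from points to a compact neighborhood \<open>C\<close>
    of the whole ball. It will contain a ball of radius larger than \<open>\<rho>\<close>,
    contradicting the choice of \<open>\<rho>\<close>.\<close>
  obtain U C where UC: "open U" "compact C" "cball p \<rho> \<subseteq> U" "U \<subseteq> C"
  proof -
    have "compactin euclidean (cball p \<rho>)" using cp by simp
    from locally_compact_space_compact_closed_compact[of "euclidean :: 'a topology"] this lc
    show ?thesis using that
      by (metis open_openin compactin_euclidean_iff Hausdorff_space_euclidean)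
  qed
  obtain e where e: "e > 0" "(\<Union>x\<in>cball p \<rho>. cball x e) \<subseteq> U"
    using compact_subset_open_imp_cball_epsilon_subset[OF cp UC(1,3)] .
  have "cball p (\<rho> + e) \<subseteq> U"
  proof
    fix x assume "x \<in> cball p (\<rho> + e)"
    then obtain y where "y \<in> cball p \<rho>" "dist y x \<le> e"
      using geodesic_space_cball_point[OF geo \<open>\<rho> \<ge> 0\<close>, of e p x] e(1) by auto
    then show "x \<in> U" using e(2) by (meson UN_I mem_cball subsetD)
  qed
  then have "C \<inter> cball p (\<rho> + e) = cball p (\<rho> + e)" using UC(4) by auto
  then have "\<rho> + e \<in> S"
    using compact_Int_closed[OF UC(2), of "cball p (\<rho> + e)"] unfolding S_def by simp
  then have "\<rho> + e \<le> \<rho>" unfolding \<rho>_def using \<open>bdd_above S\<close> by (rule cSup_upper)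
  with e(1) show False by simp
qed

lemma compact_cball_imp_PK_regular:
  assumes "\<And>(p :: 'a::metric_space) r. compact (cball p r)"
  shows "PK_regular TYPE('a) TYPE('i)"
  unfolding PK_regular_def
proof (intro allI impI)
  fix A :: "'i set" and r :: "'i rel" and K :: "'i \<Rightarrow> 'a set"
  assume A: "directed_set A r" "nondecreasing_net A r K" and "bounded_net A K"
  then obtain p e where "closure (\<Union>a\<in>A. K a) \<subseteq> cball p e"
    unfolding bounded_net_def bounded_subset_cball
    by (metis closed_cball closure_minimal bounded_def mem_cball subsetI)
  then have "compact (closure (\<Union>a\<in>A. K a))"
    using compact_Int_closed[OF assms closed_closure] by (metis inf.absorb2)
  then show "\<exists>L. has_PK_Lim A r K L \<and> compact L"
    using has_PK_Lim_nondecreasing[OF A] by blast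
qed

lemma PK_regular_bounded_sequence:
  fixes f :: "nat \<Rightarrow> 'a::metric_space"
  assumes "PK_regular TYPE('a) TYPE('a set)" "bounded (range f)"
  shows "compact (closure (range f))"
proof -
  have reg: "PK_regular TYPE('a) TYPE(nat)" using assms(1) by (rule PK_regular_index)
  let ?r = "{(m, n :: nat). m \<le> n}" and ?K = "\<lambda>n. f ` {..n}"
  have U: "(\<Union>n. ?K n) = range f" by auto
  have "\<exists>c. a \<le> c \<and> b \<le> c" for a b :: nat
    using max.cobounded1 max.cobounded2 by blast
  then have dir: "directed_set UNIV ?r"
    unfolding directed_set_def preorder_on_def refl_on_def trans_def by auto
  have nd: "nondecreasing_net UNIV ?r ?K"
    unfolding nondecreasing_net_def by force
  have "chain_net UNIV ?K"
    unfolding chain_net_def by (metis atMost_subset_iff image_mono nle_le)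
  moreover have "bounded_net UNIV ?K" using assms(2) unfolding bounded_net_def U .
  moreover have "\<forall>n\<in>UNIV. compact (?K n)" by (simp add: finite_imp_compact)
  ultimately obtain L where "has_PK_Lim UNIV ?r ?K L" "compact L"
    using reg[unfolded PK_regular_def] dir nd by meson
  moreover have "has_PK_Lim UNIV ?r ?K (closure (range f))"
    using has_PK_Lim_nondecreasing[OF dir nd] unfolding U .
  ultimately show ?thesis unfolding has_PK_Lim_def by simp
qed

lemma PK_regular_imp_compact_cball:
  fixes p :: "'a::metric_space"
  assumes "PK_regular TYPE('a) TYPE('a set)"
  shows "compact (cball p r)"
  unfolding compact_def
proof (intro allI impI)
  fix f :: "nat \<Rightarrow> 'a" assume f: "\<forall>n. f n \<in> cball p r"
  then have "bounded (range f)"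
    by (metis bounded_cball bounded_subset image_subsetI)
  then have "compact (closure (range f))"
    by (rule PK_regular_bounded_sequence[OF assms])
  moreover have "\<forall>n. f n \<in> closure (range f)"
    using closure_subset[of "range f"] by blast
  ultimately obtain l h where "strict_mono (h :: nat \<Rightarrow> nat)" "(f \<circ> h) \<longlonglongrightarrow> l"
    unfolding compact_def by blast
  \<comment> \<open>The limit was found in the closure of the range; closedness of the ball keeps it
    inside.\<close>
  moreover then have "l \<in> cball p r"
    using closed_sequentially[OF closed_cball, of "f \<circ> h" p r l] f by simp
  ultimately show "\<exists>l\<in>cball p r. \<exists>h. strict_mono h \<and> (f \<circ> h) \<longlonglongrightarrow> l"
    by blast
qed

lemma compact_cball_imp_locally_compact_space:
  assumes "\<And>(p :: 'a::metric_space) r. compact (cball p r)"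
  shows "locally_compact_space (euclidean :: 'a topology)"
  unfolding locally_compact_space_def
proof
  fix p :: 'a
  have "openin euclidean (ball p 1) \<and> compactin euclidean (cball p 1) \<and>
      p \<in> ball p 1 \<and> ball p 1 \<subseteq> cball p 1"
    using assms by auto
  then show "\<exists>U K. openin euclidean U \<and> compactin euclidean K \<and> p \<in> U \<and> U \<subseteq> K"
    by blast
qed

theorem theorem1:
  assumes "geodesic_space TYPE('a::complete_space)"
  shows "(locally_compact_space (euclidean :: 'a topology) \<longleftrightarrow> PK_regular TYPE('a) TYPE('a set)) \<and>
         (locally_compact_space (euclidean :: 'a topology) \<longrightarrow> PK_regular TYPE('a) TYPE('i))"
  \<comment> \<open>Compactness of all closed balls links the two conditions, and it yields
    regularity for every index type.\<close>
  using locally_compact_geodesic_compact_cball[OF assms]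
    compact_cball_imp_PK_regular PK_regular_imp_compact_cball
    compact_cball_imp_locally_compact_space by metis

end
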